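(* Let $Y$ be a Hilbert space, let $X$ be a set and let $v\colon X\to Y$ be a map. Let $A\subset X$ and let $u\colon A\to Y$ satisfy $$\lVert u(x)-u(y)\rVert\leq \lVert v(x)-v(y)\rVert\quad\text{for all }x,y\in A.$$ Then there exists an extension $\tilde{u}\colon X\to Y$ of $u$ such that $$\lVert \tilde{u}(x)-\tilde{u}(y)\rVert\leq \lVert v(x)-v(y)\rVert\quad\text{for all }x,y\in X.$$ Moreover, if for some $\delta\geq 0$ we have $\lVert v(x)-u(x)\rVert\leq \delta$ for all $x\in A$, then there exists an extension $\tilde{u}\colon X\to Y$ of $u$ such that $\lVert \tilde{u}(x)-\tilde{u}(y)\rVert\leq \lVert v(x)-v(y)\rVert$ for all $x,y\in X$ and $\lVert v(x)-\tilde{u}(x)\rVert\leq \delta$ for all $x\in X$.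
   Context: An extension of $u\colon A\to Y$ to $X$ is a map $\tilde u\colon X\to Y$ with $\tilde{u}|_A=u$. No structure on $X$ is assumed and $v$ is an arbitrary map. *)

theory Defs
  imports "HOL-Analysis.Analysis"
begin

end

theory Submission
  imports Defs
begin

text \<open>
  Only the values of \<open>v\<close> matter: \<open>u\<close> is a nonexpansive relation \<open>G \<subseteq> Y \<times> Y\<close> consisting of pairs
  \<open>(v x, u x)\<close>, and by Zorn's lemma it suffices to extend \<open>G\<close> to one more point \<open>x\<close>.  After translating
  \<open>x\<close> to the origin, a value \<open>y\<close> is admissible iff the affine function \<open>p \<mapsto> 2 \<langle>y, p\<rangle> - \<parallel>y\<parallel>\<^sup>2\<close>,
  whose graph is tangent to the paraboloid \<open>s = \<parallel>p\<parallel>\<^sup>2\<close>, lies above all points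
  \<open>(p, \<parallel>p\<parallel>\<^sup>2 - \<parallel>q\<parallel>\<^sup>2)\<close> with \<open>(q, p) \<in> G\<close>.  Such a tangent exists as soon as the convex hull
  of these points lies below the paraboloid, and this follows from nonexpansiveness because
  \<open>\<parallel>p - p'\<parallel>\<^sup>2 - \<parallel>q - q'\<parallel>\<^sup>2\<close> is affine in each of the two triples
  \<open>(p, q, \<parallel>p\<parallel>\<^sup>2 - \<parallel>q\<parallel>\<^sup>2)\<close> and \<open>(p', q', \<parallel>p'\<parallel>\<^sup>2 - \<parallel>q'\<parallel>\<^sup>2)\<close>.  The bound \<open>\<parallel>y\<parallel> \<le> \<delta>\<close> amounts to
  adding the point \<open>(0, - \<delta>\<^sup>2)\<close>.
\<close>

section \<open>Tangents to the paraboloid above a convex set\<close>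

lemma paraboloid_convex_combination:
  fixes a b :: "'y::real_inner"
  shows "((1 - t) * r + t * s) - (norm ((1 - t) *\<^sub>R a + t *\<^sub>R b))\<^sup>2 =
    (1 - t) * (r - (norm a)\<^sup>2) + t * (s - (norm b)\<^sup>2) + t * (1 - t) * (norm (a - b))\<^sup>2"
  unfolding power2_norm_eq_inner
  by (simp add: inner_simps inner_commute algebra_simps)

text \<open>The height \<open>\<phi>\<close> over the paraboloid is strongly concave along segments,
  so maximizing sequences have Cauchy base points even when the supremum \<open>M\<close> is not
  attained. At their limit \<open>y\<close> the first-order condition reads
  \<open>\<phi> (z, s) + (norm (y - z))\<^sup>2 \<le> M \<le> 0\<close>, which expands to the
  claim.\<close>

lemma ex_tangent_above_convex:
  fixes K :: "('y::{real_inner, complete_space} \<times> real) set"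
  assumes "convex K" and below: "\<And>z s. (z, s) \<in> K \<Longrightarrow> s \<le> (norm z)\<^sup>2"
  shows "\<exists>y. \<forall>(z, s)\<in>K. s + (norm y)\<^sup>2 \<le> 2 * inner y z"
proof (cases "K = {}")
  case False
  define \<phi> where "\<phi> = (\<lambda>k :: 'y \<times> real. snd k - (norm (fst k))\<^sup>2)"
  define M where "M = Sup (\<phi> ` K)"
  have bdd: "bdd_above (\<phi> ` K)"
    using below by (auto simp: \<phi>_def intro!: bdd_aboveI[where M = 0])
  have le_M: "\<phi> k \<le> M" if "k \<in> K" for k
    unfolding M_def using bdd that by (simp add: cSUP_upper)
  have "M \<le> 0"
    unfolding M_def using False below by (auto simp: \<phi>_def intro!: cSUP_least)
  have mix: "(1 - t) * \<phi> a + t * \<phi> b + t * (1 - t) * (norm (fst a - fst b))\<^sup>2 \<le> M"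
    if "a \<in> K" "b \<in> K" "0 \<le> t" "t \<le> 1" for a b t
  proof -
    have "(1 - t) *\<^sub>R a + t *\<^sub>R b \<in> K"
      using \<open>convex K\<close> that by (auto simp: convex_alt)
    from le_M[OF this] show ?thesis
      using paraboloid_convex_combination[of t "snd a" "snd b" "fst a" "fst b"] by (simp add: \<phi>_def)
  qed
  have "\<forall>n. \<exists>k. k \<in> K \<and> M - 1 / real (Suc n) < \<phi> k"
  proof
    fix n
    have "M - 1 / real (Suc n) < Sup (\<phi> ` K)"
      unfolding M_def by simp
    then show "\<exists>k. k \<in> K \<and> M - 1 / real (Suc n) < \<phi> k"
      unfolding less_cSUP_iff[OF False bdd] by blast
  qed
  from choice[OF this] obtain k where k: "\<And>n. k n \<in> K" "\<And>n. M - 1 / real (Suc n) < \<phi> (k n)"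
    by blast
  have "(\<lambda>n. M - 1 / real (Suc n)) \<longlonglongrightarrow> M - 0"
    by (intro tendsto_intros LIMSEQ_Suc[OF lim_1_over_n])
  then have "(\<lambda>n. M - 1 / real (Suc n)) \<longlonglongrightarrow> M"
    by simp
  then have lim_\<phi>: "(\<lambda>n. \<phi> (k n)) \<longlonglongrightarrow> M"
  proof (rule tendsto_sandwich[rotated 2])
    show "(\<lambda>n. M) \<longlonglongrightarrow> M"
      by simp
    show "\<forall>\<^sub>F n in sequentially. M - 1 / real (Suc n) \<le> \<phi> (k n)"
      using k(2) by (intro always_eventually allI less_imp_le)
    show "\<forall>\<^sub>F n in sequentially. \<phi> (k n) \<le> M"
      using k(1) by (intro always_eventually allI le_M)
  qed
  have "Cauchy (\<lambda>n. fst (k n))"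
  proof (rule metric_CauchyI)
    fix e :: real
    assume "e > 0"
    \<comment> \<open>The factor 1/4 is the value of \<open>t * (1 - t)\<close> at the midpoint,
      where \<open>mix\<close> is applied.\<close>
    then have "\<forall>\<^sub>F n in sequentially. M - e\<^sup>2 / 4 < \<phi> (k n)"
      using lim_\<phi> by (intro order_tendstoD) auto
    then obtain N where N: "\<And>n. n \<ge> N \<Longrightarrow> M - e\<^sup>2 / 4 < \<phi> (k n)"
      by (auto simp: eventually_sequentially)
    have "dist (fst (k m)) (fst (k n)) < e" if "m \<ge> N" "n \<ge> N" for m n
    proof -
      have "(norm (fst (k m) - fst (k n)))\<^sup>2 < e\<^sup>2"
        using mix[of "k m" "k n" "1/2"] k(1) N[OF that(1)] N[OF that(2)] by simp
      then show ?thesis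
        using \<open>e > 0\<close> by (simp add: dist_norm power2_less_imp_less)
    qed
    then show "\<exists>N. \<forall>m\<ge>N. \<forall>n\<ge>N. dist (fst (k m)) (fst (k n)) < e"
      by blast
  qed
  then obtain y where y: "(\<lambda>n. fst (k n)) \<longlonglongrightarrow> y"
    using Cauchy_convergent convergent_def by blast
  have "s + (norm y)\<^sup>2 \<le> 2 * inner y z" if zs: "(z, s) \<in> K" for z s
  proof -
    have *: "\<phi> (z, s) + (1 - t) * (norm (y - z))\<^sup>2 \<le> M" if t: "0 < t" "t \<le> 1" for t
    proof -
      \<comment> \<open>Here \<open>n\<close> tends to infinity in \<open>mix\<close> on the segment
        from \<open>k n\<close> to \<open>(z, s)\<close>; the terms \<open>(1 - t) * M\<close> then
        combine with \<open>M\<close>, and a factor \<open>t > 0\<close> cancels.\<close>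
      have "(\<lambda>n. (1 - t) * \<phi> (k n) + t * \<phi> (z, s) + t * (1 - t) * (norm (fst (k n) - z))\<^sup>2)
          \<longlonglongrightarrow> (1 - t) * M + t * \<phi> (z, s) + t * (1 - t) * (norm (y - z))\<^sup>2"
        by (intro tendsto_intros lim_\<phi> y)
      moreover have "(1 - t) * \<phi> (k n) + t * \<phi> (z, s) + t * (1 - t) * (norm (fst (k n) - z))\<^sup>2 \<le> M" for n
        using mix[OF k(1) zs, of t] t by simp
      ultimately have "(1 - t) * M + t * \<phi> (z, s) + t * (1 - t) * (norm (y - z))\<^sup>2 \<le> M"
        by (intro LIMSEQ_le_const2) auto
      then have "t * (\<phi> (z, s) + (1 - t) * (norm (y - z))\<^sup>2) \<le> t * M"
        by (simp add: algebra_simps)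
      then show ?thesis
        using t by simp
    qed
    have "((\<lambda>t. \<phi> (z, s) + (1 - t) * (norm (y - z))\<^sup>2)
        \<longlongrightarrow> \<phi> (z, s) + (1 - 0) * (norm (y - z))\<^sup>2) (at_right 0)"
      by (intro tendsto_intros)
    moreover have "\<forall>\<^sub>F t in at_right (0::real). \<phi> (z, s) + (1 - t) * (norm (y - z))\<^sup>2 \<le> M"
      using eventually_at_right_real[of 0 "1 :: real"] by (rule eventually_mono) (auto intro: *)
    ultimately have "\<phi> (z, s) + (1 - 0) * (norm (y - z))\<^sup>2 \<le> M"
      by (rule tendsto_upperbound) simp
    then show ?thesis
      using \<open>M \<le> 0\<close> by (simp add: \<phi>_def power2_norm_eq_inner inner_simps inner_commute)
  qed
  then show ?thesis
    by auto
qed auto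

section \<open>Convex hull of the lifted relation\<close>

definition nonexpansive :: "('y::real_normed_vector \<times> 'y) set \<Rightarrow> bool" where
  "nonexpansive G \<longleftrightarrow> (\<forall>(q, p)\<in>G. \<forall>(q', p')\<in>G. norm (p - p') \<le> norm (q - q'))"

text \<open>The coordinate \<open>q - x\<close> is kept so that the quadratic form below is affine
  in each argument; it is projected away before the tangent is taken.\<close>

definition lift :: "'y::real_inner \<Rightarrow> 'y \<times> 'y \<Rightarrow> 'y \<times> 'y \<times> real" where
  "lift x = (\<lambda>(q, p). (p - x, q - x, (norm (p - x))\<^sup>2 - (norm (q - x))\<^sup>2))"

text \<open>On lifted pairs \<open>B\<close> equals
  \<open>(norm (p - p'))\<^sup>2 - (norm (q - q'))\<^sup>2\<close>. Being symmetric and affine in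
  each argument, it stays nonpositive when first one argument and then the other runs through the
  hull; the claim is half of its value on the diagonal.\<close>

lemma convex_hull_lift_below:
  assumes G: "nonexpansive G" and zws: "(z, w, s) \<in> convex hull (lift x ` G)"
  shows "s \<le> (norm z)\<^sup>2 - (norm w)\<^sup>2"
proof -
  define B where "B = (\<lambda>(z :: 'a, w :: 'a, s :: real) (z', w', s').
    s + s' - 2 * inner z z' + 2 * inner w w')"
  have B_commute: "B k l = B l k" for k l
    by (auto simp: B_def inner_commute split: prod.splits)
  have conv: "convex {k. B k l \<le> 0}" for l
  proof (rule convexI)
    fix a b :: "'a \<times> 'a \<times> real" and \<alpha> \<beta> :: real
    assume ab: "a \<in> {k. B k l \<le> 0}" "b \<in> {k. B k l \<le> 0}" and wt: "0 \<le> \<alpha>" "0 \<le> \<beta>" "\<alpha> + \<beta> = 1"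
    have \<beta>: "\<beta> = 1 - \<alpha>" using wt by simp
    have "B (\<alpha> *\<^sub>R a + \<beta> *\<^sub>R b) l = \<alpha> * B a l + \<beta> * B b l"
      unfolding \<beta> by (auto simp: B_def inner_simps algebra_simps split: prod.splits)
    also have "\<dots> \<le> 0"
      using ab wt by (simp add: add_nonpos_nonpos mult_nonneg_nonpos)
    finally show "\<alpha> *\<^sub>R a + \<beta> *\<^sub>R b \<in> {k. B k l \<le> 0}"
      by simp
  qed
  have "B k l \<le> 0" if kl: "k \<in> lift x ` G" "l \<in> lift x ` G" for k l
  proof -
    obtain q p q' p' where mem: "(q, p) \<in> G" "(q', p') \<in> G"
      and kl: "k = lift x (q, p)" "l = lift x (q', p')"
      using kl by auto
    have "(norm (p - p'))\<^sup>2 \<le> (norm (q - q'))\<^sup>2"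
      using G mem by (auto simp: nonexpansive_def intro!: power_mono)
    then show ?thesis
      by (simp add: kl B_def lift_def power2_norm_eq_inner inner_simps inner_commute)
  qed
  then have "convex hull (lift x ` G) \<subseteq> {k. B k l \<le> 0}" if "l \<in> lift x ` G" for l
    using that by (intro hull_minimal conv subsetI CollectI)
  then have "B k l \<le> 0" if "k \<in> convex hull (lift x ` G)" "l \<in> lift x ` G" for k l
    using that by blast
  then have "B l k \<le> 0" if "k \<in> convex hull (lift x ` G)" "l \<in> lift x ` G" for k l
    unfolding B_commute[of l k] using that by blast
  then have "convex hull (lift x ` G) \<subseteq> {l. B l k \<le> 0}" if "k \<in> convex hull (lift x ` G)" for k
    using that by (intro hull_minimal conv subsetI CollectI)
  then have "B (z, w, s) (z, w, s) \<le> 0"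
    using zws by auto
  then show ?thesis
    by (simp add: B_def power2_norm_eq_inner)
qed

text \<open>On a lifted pair \<open>z - w\<close> is \<open>p - q\<close>, so the hull stays in the
  preimage of a ball under a linear map.\<close>

lemma convex_hull_lift_bounded:
  assumes "\<forall>(q, p)\<in>G. norm (q - p) \<le> \<delta>" and "(z, w, s) \<in> convex hull (lift x ` G)"
  shows "norm (z - w) \<le> \<delta>"
proof -
  have "convex ((\<lambda>(z :: 'a, w :: 'a, s :: real). z - w) -` cball 0 \<delta>)"
    by (intro convex_linear_vimage convex_cball linearI) (auto simp: algebra_simps)
  moreover have "lift x ` G \<subseteq> (\<lambda>(z :: 'a, w :: 'a, s :: real). z - w) -` cball 0 \<delta>"
    using assms(1) by (auto simp: lift_def norm_minus_commute)
  ultimately have "convex hull (lift x ` G) \<subseteq> (\<lambda>(z :: 'a, w :: 'a, s :: real). z - w) -` cball 0 \<delta>"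
    by (rule hull_minimal[rotated])
  then show ?thesis
    using assms(2) by auto
qed

text \<open>Projection commutes with convex hulls. This recovers the coordinate \<open>w\<close> on
  which the hull estimates depend.\<close>

lemma convex_hull_drop_middle:
  assumes "(z, s) \<in> convex hull ((\<lambda>(z, w, s). (z, s)) ` L)"
  obtains w where "(z, w, s) \<in> convex hull L"
proof -
  have "linear (\<lambda>(z :: 'a::real_vector, w :: 'c::real_vector, s :: 'b::real_vector). (z, s))"
    by (intro linearI) auto
  from assms[folded convex_hull_linear_image[OF this]] show thesis
    using that by (elim imageE) (auto split: prod.splits)
qed

text \<open>The tangent inequality at the point of \<open>(q, p)\<close> is the squared claim,
  expanded. Any \<open>K\<close> containing the projected points is allowed, so an extra point may
  be added.\<close>

lemma tangent_above_lift_imp: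
  assumes "(\<lambda>(z, w, s). (z, s)) ` lift x ` G \<subseteq> K"
    and "\<forall>(z, s)\<in>K. s + (norm y)\<^sup>2 \<le> 2 * inner y z"
    and "(q, p) \<in> G"
  shows "norm (x + y - p) \<le> norm (x - q)"
proof -
  have "(p - x, (norm (p - x))\<^sup>2 - (norm (q - x))\<^sup>2) \<in> K"
    using assms(1,3) by (force simp: lift_def)
  then have "(norm (p - x))\<^sup>2 - (norm (q - x))\<^sup>2 + (norm y)\<^sup>2 \<le> 2 * inner y (p - x)"
    using assms(2) by fast
  then have "(norm (x + y - p))\<^sup>2 \<le> (norm (x - q))\<^sup>2"
    by (simp add: power2_norm_eq_inner inner_simps inner_commute)
  then show ?thesis
    by (rule power2_le_imp_le) simp
qed

section \<open>One-point extensions\<close>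

lemma nonexpansive_extend_point:
  fixes G :: "('y::{real_inner, complete_space} \<times> 'y) set"
  assumes "nonexpansive G"
  shows "\<exists>y. \<forall>(q, p)\<in>G. norm (y - p) \<le> norm (x - q)"
proof -
  define S where "S = (\<lambda>(z, w, s). (z, s)) ` lift x ` G"
  define K where "K = convex hull S"
  have "s \<le> (norm z)\<^sup>2" if zs: "(z, s) \<in> K" for z s
  proof -
    obtain w where "(z, w, s) \<in> convex hull (lift x ` G)"
      using zs unfolding K_def S_def by (rule convex_hull_drop_middle)
    from convex_hull_lift_below[OF assms this] show ?thesis
      by (smt (verit) zero_le_power2)
  qed
  then obtain y where "\<forall>(z, s)\<in>K. s + (norm y)\<^sup>2 \<le> 2 * inner y z"
    using ex_tangent_above_convex[of K] by (auto simp: K_def)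
  moreover have "S \<subseteq> K"
    unfolding K_def by (rule hull_subset)
  ultimately show ?thesis
    using tangent_above_lift_imp[of x G K y] unfolding S_def by (intro exI[of _ "x + y"]) blast
qed

lemma nonexpansive_extend_point_bounded:
  fixes G :: "('y::{real_inner, complete_space} \<times> 'y) set"
  assumes G: "nonexpansive G" and bnd: "\<forall>(q, p)\<in>G. norm (q - p) \<le> \<delta>" and "\<delta> \<ge> 0"
  shows "\<exists>y. norm (x - y) \<le> \<delta> \<and> (\<forall>(q, p)\<in>G. norm (y - p) \<le> norm (x - q))"
proof (cases "G = {}")
  case True
  then show ?thesis
    using \<open>\<delta> \<ge> 0\<close> by (intro exI[of _ x]) auto
next
  case False
  define S where "S = (\<lambda>(z, w, s). (z, s)) ` lift x ` G"
  define K where "K = convex hull (insert (0, - \<delta>\<^sup>2) S)"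
  have "s \<le> (norm z)\<^sup>2" if zs: "(z, s) \<in> K" for z s
  proof -
    have "S \<noteq> {}" using False by (simp add: S_def)
    obtain \<nu> \<mu> k where \<mu>: "0 \<le> \<nu>" "0 \<le> \<mu>" "\<nu> + \<mu> = 1" and k: "k \<in> convex hull S"
        "(z, s) = \<nu> *\<^sub>R (0, - \<delta>\<^sup>2) + \<mu> *\<^sub>R k"
      using zs unfolding K_def convex_hull_insert[OF \<open>S \<noteq> {}\<close>] by blast
    obtain z' s' where mem: "(z', s') \<in> convex hull S"
      and zs_eq: "(z, s) = \<nu> *\<^sub>R (0, - \<delta>\<^sup>2) + \<mu> *\<^sub>R (z', s')"
      using k by (cases k) auto
    obtain w where w: "(z', w, s') \<in> convex hull (lift x ` G)"
      using mem unfolding S_def by (rule convex_hull_drop_middle)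
    have \<nu>: "\<nu> = 1 - \<mu>" using \<mu> by simp
    \<comment> \<open>Since \<open>s' \<le> (norm z')\<^sup>2 - (norm w)\<^sup>2\<close>, it
      suffices that \<open>\<mu> * (1 - \<mu>) * (norm z')\<^sup>2 \<le> \<mu> * (norm w)\<^sup>2 +
      (1 - \<mu>) * \<delta>\<^sup>2\<close>. The displacement bound gives this up to a perfect
      square of the right sign.\<close>
    have "norm z' \<le> norm w + \<delta>"
      using convex_hull_lift_bounded[OF bnd w] norm_triangle_sub[of z' w] by simp
    then have "(norm z')\<^sup>2 \<le> (norm w + \<delta>)\<^sup>2"
      by (intro power_mono) auto
    then have "\<mu> * (1 - \<mu>) * (norm z')\<^sup>2 \<le> \<mu> * (1 - \<mu>) * (norm w + \<delta>)\<^sup>2"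
      using \<mu> \<nu> by (intro mult_left_mono) auto
    also have "\<dots> = \<mu> * (norm w)\<^sup>2 + (1 - \<mu>) * \<delta>\<^sup>2 - (\<mu> * norm w - (1 - \<mu>) * \<delta>)\<^sup>2"
      by algebra
    also have "\<dots> \<le> \<mu> * (norm w)\<^sup>2 + (1 - \<mu>) * \<delta>\<^sup>2"
      by simp
    finally have "\<mu> * ((norm z')\<^sup>2 - (norm w)\<^sup>2) - (1 - \<mu>) * \<delta>\<^sup>2 \<le> \<mu>\<^sup>2 * (norm z')\<^sup>2"
      by (simp add: algebra_simps power2_eq_square)
    moreover have "\<mu> * s' \<le> \<mu> * ((norm z')\<^sup>2 - (norm w)\<^sup>2)"
      using convex_hull_lift_below[OF G w] \<mu> by (intro mult_left_mono)
    ultimately show ?thesis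
      using zs_eq by (simp add: \<nu> power_mult_distrib)
  qed
  then obtain y where y: "\<forall>(z, s)\<in>K. s + (norm y)\<^sup>2 \<le> 2 * inner y z"
    using ex_tangent_above_convex[of K] by (auto simp: K_def)
  have "insert (0, - \<delta>\<^sup>2) S \<subseteq> K"
    unfolding K_def by (rule hull_subset)
  then have "(0, - \<delta>\<^sup>2) \<in> K" and "S \<subseteq> K"
    by auto
  \<comment> \<open>At \<open>(0, - \<delta>\<^sup>2)\<close> the inner product in the tangent
    inequality vanishes.\<close>
  with y have "(norm y)\<^sup>2 \<le> \<delta>\<^sup>2"
    by fastforce
  then have "norm y \<le> \<delta>"
    using \<open>\<delta> \<ge> 0\<close> by (rule power2_le_imp_le)
  then show ?thesis
    using tangent_above_lift_imp[OF \<open>S \<subseteq> K\<close>[unfolded S_def] y] by (intro exI[of _ "x + y"]) auto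
qed

section \<open>Extension to the whole space\<close>

text \<open>The constraint \<open>Q\<close> on pairs lets one Zorn argument serve both claims. A
  maximal relation has full domain by \<open>extend\<close>, and nonexpansiveness at equal first
  components makes it single-valued.\<close>

lemma nonexpansive_extend_all:
  fixes G :: "('y::real_normed_vector \<times> 'y) set"
  assumes G: "nonexpansive G" "G \<subseteq> Q"
    and extend: "\<And>H x. nonexpansive H \<Longrightarrow> H \<subseteq> Q \<Longrightarrow>
      \<exists>y. (x, y) \<in> Q \<and> (\<forall>(q, p)\<in>H. norm (y - p) \<le> norm (x - q))"
  shows "\<exists>f. (\<forall>(q, p)\<in>G. f q = p) \<and> (\<forall>x y. norm (f x - f y) \<le> norm (x - y)) \<and> (\<forall>x. (x, f x) \<in> Q)"
proof -
  define \<A> where "\<A> = {H. nonexpansive H \<and> G \<subseteq> H \<and> H \<subseteq> Q}"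
  have "\<exists>H\<in>\<A>. \<forall>H'\<in>\<A>. H \<subseteq> H' \<longrightarrow> H' = H"
  proof (rule subset_Zorn_nonempty)
    show "\<A> \<noteq> {}"
      using G by (auto simp: \<A>_def)
  next
    fix C
    assume "C \<noteq> {}" and C: "subset.chain \<A> C"
    have "nonexpansive (\<Union>C)"
      unfolding nonexpansive_def
    proof clarify
      fix q p H q' p' H'
      assume mem: "H \<in> C" "(q, p) \<in> H" "H' \<in> C" "(q', p') \<in> H'"
      then have "H \<subseteq> H' \<or> H' \<subseteq> H"
        using C by (auto simp: subset_chain_def)
      moreover have "nonexpansive H" "nonexpansive H'"
        using C mem by (auto simp: subset_chain_def \<A>_def)
      ultimately show "norm (p - p') \<le> norm (q - q')"
        using mem unfolding nonexpansive_def by blast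
    qed
    then show "\<Union>C \<in> \<A>"
      using C \<open>C \<noteq> {}\<close> unfolding subset_chain_def \<A>_def by blast
  qed
  then obtain H where "H \<in> \<A>" and max: "\<And>H'. H' \<in> \<A> \<Longrightarrow> H \<subseteq> H' \<Longrightarrow> H' = H"
    by blast
  then have H: "nonexpansive H" "G \<subseteq> H" "H \<subseteq> Q"
    by (auto simp: \<A>_def)
  have "\<exists>y. (x, y) \<in> H" for x
  proof -
    obtain y where y: "(x, y) \<in> Q" "\<forall>(q, p)\<in>H. norm (y - p) \<le> norm (x - q)"
      using extend[OF H(1,3)] by blast
    then have "nonexpansive (insert (x, y) H)"
      using H(1) by (auto simp: nonexpansive_def norm_minus_commute)
    then have "insert (x, y) H \<in> \<A>"
      using H y(1) by (auto simp: \<A>_def)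
    then show ?thesis
      using max by blast
  qed
  then obtain f where f: "\<And>x. (x, f x) \<in> H"
    by metis
  have nonexp: "norm (p - p') \<le> norm (q - q')" if "(q, p) \<in> H" "(q', p') \<in> H" for q p q' p'
    using H(1) that by (auto simp: nonexpansive_def)
  have "f q = p" if "(q, p) \<in> G" for q p
    using nonexp[OF f[of q], of q p] that H(2) by auto
  then show ?thesis
    using nonexp f H(3) by (intro exI[of _ f]) blast
qed

theorem proposition3p6:
  fixes X A :: "'x set"
    and u v :: "'x \<Rightarrow> 'y::{real_inner, complete_space}"
  assumes "A \<subseteq> X"
    and "\<forall>x\<in>A. \<forall>y\<in>A. norm (u x - u y) \<le> norm (v x - v y)"
  shows "(\<exists>u' :: 'x \<Rightarrow> 'y. (\<forall>x\<in>A. u' x = u x) \<and>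
            (\<forall>x\<in>X. \<forall>y\<in>X. norm (u' x - u' y) \<le> norm (v x - v y))) \<and>
         (\<forall>\<delta>\<ge>0. (\<forall>x\<in>A. norm (v x - u x) \<le> \<delta>) \<longrightarrow>
            (\<exists>u' :: 'x \<Rightarrow> 'y. (\<forall>x\<in>A. u' x = u x) \<and>
               (\<forall>x\<in>X. \<forall>y\<in>X. norm (u' x - u' y) \<le> norm (v x - v y)) \<and>
               (\<forall>x\<in>X. norm (v x - u' x) \<le> \<delta>)))"
proof (intro conjI allI impI)
  \<comment> \<open>Passing to a relation allows \<open>v\<close> to be non-injective; pairs with
    equal \<open>v\<close>-values have equal \<open>u\<close>-values by the hypothesis.\<close>
  let ?G = "(\<lambda>x. (v x, u x)) ` A"
  have G: "nonexpansive ?G"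
    using assms(2) by (auto simp: nonexpansive_def)
  have "\<exists>f. (\<forall>(q, p)\<in>?G. f q = p) \<and> (\<forall>x y. norm (f x - f y) \<le> norm (x - y)) \<and>
      (\<forall>x. (x, f x) \<in> UNIV)"
    by (rule nonexpansive_extend_all[OF G]) (simp_all add: nonexpansive_extend_point)
  then obtain f where "\<forall>(q, p)\<in>?G. f q = p" "\<forall>x y. norm (f x - f y) \<le> norm (x - y)"
    by blast
  then show "\<exists>u'. (\<forall>x\<in>A. u' x = u x) \<and> (\<forall>x\<in>X. \<forall>y\<in>X. norm (u' x - u' y) \<le> norm (v x - v y))"
    by (intro exI[of _ "f \<circ> v"]) auto
  fix \<delta> :: real
  assume "\<delta> \<ge> 0" and bnd: "\<forall>x\<in>A. norm (v x - u x) \<le> \<delta>"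
  \<comment> \<open>Under \<open>q = v x\<close> and \<open>p = f (v x)\<close>, membership in this
    set is the displacement bound for the extension \<open>f \<circ> v\<close>.\<close>
  let ?Q = "{(q :: 'y, p). norm (q - p) \<le> \<delta>}"
  have "\<exists>f. (\<forall>(q, p)\<in>?G. f q = p) \<and> (\<forall>x y. norm (f x - f y) \<le> norm (x - y)) \<and>
      (\<forall>x. (x, f x) \<in> ?Q)"
  proof (rule nonexpansive_extend_all[OF G])
    show "?G \<subseteq> ?Q"
      using bnd by auto
  next
    fix H :: "('y \<times> 'y) set" and x
    assume "nonexpansive H" "H \<subseteq> ?Q"
    then show "\<exists>y. (x, y) \<in> ?Q \<and> (\<forall>(q, p)\<in>H. norm (y - p) \<le> norm (x - q))"
      using nonexpansive_extend_point_bounded[of H \<delta> x] \<open>\<delta> \<ge> 0\<close> by auto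
  qed
  then obtain f where "\<forall>(q, p)\<in>?G. f q = p" "\<forall>x y. norm (f x - f y) \<le> norm (x - y)"
    "\<forall>x. norm (x - f x) \<le> \<delta>"
    by blast
  then show "\<exists>u'. (\<forall>x\<in>A. u' x = u x) \<and>
      (\<forall>x\<in>X. \<forall>y\<in>X. norm (u' x - u' y) \<le> norm (v x - v y)) \<and> (\<forall>x\<in>X. norm (v x - u' x) \<le> \<delta>)"
    by (intro exI[of _ "f \<circ> v"]) auto
qed

end
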